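(* Let $\Sigma$ be an alphabet and let $D=(D,+,\mathrm{Val}^\omega,\diamond,0,1)$ be a product $\omega$-valuation monoid ($\omega$-pv-monoid). (a) Suppose $D$ is left-distributive and $\varphi\in \mathit{MSO}(D,\mathit{NW}(\Sigma))$ is $\wedge$-restricted. Then there exists a strongly-$\wedge$-restricted formula $\varphi'\in \mathit{MSO}(D,\mathit{NW}(\Sigma))$ with $[\![\varphi]\!]=[\![\varphi']\!]$. Moreover, if $\varphi$ is also $\forall$-restricted, then $\varphi'$ can also be chosen to be $\forall$-restricted. (b) Suppose $D$ is a cc-$\omega$-valuation semiring and $\varphi\in \mathit{MSO}(D,\mathit{NW}(\Sigma))$ is commutatively-$\wedge$-restricted. Then there exists a strongly-$\wedge$-restricted formula $\varphi'\in \mathit{MSO}(D,\mathit{NW}(\Sigma))$ with $[\![\varphi]\!]=[\![\varphi']\!]$. Moreover, if $\varphi$ is also $\forall$-restricted, then $\varphi'$ can also be chosen to be $\forall$-restricted.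
   Context: Alphabets are finite; $\mathbb N=\{1,2,\dots\}$. **Nested $\omega$-words.** A matching relation $\nu$ is a subset of $(\{-\infty\}\cup\mathbb N)\times(\mathbb N\cup\{\infty\})$ with: (i) $\nu(i,j)\Rightarrow i<j$; (ii) for all $i\in\mathbb N$, $|\{j:\nu(i,j)\}|\le 1$ and $|\{j:\nu(j,i)\}|\le1$; (iii) $\nu(i,j)\wedge\nu(i',j')\wedge i<i'\Rightarrow j<i'\vee j\ge j'$; (iv) $(-\infty,\infty)\notin\nu$. A nested $\omega$-word over $\Sigma$ is a pair $\mathit{nw}=(a_1a_2\dots,\nu)$ of an $\omega$-word over $\Sigma$ and a matching relation; $\mathit{NW}^\omega(\Sigma)$ is the set of all of them. If $\nu(i,j)$, then $i$ (if in $\mathbb N$) is a call and $j$ (if in $\mathbb N$) is a return. **Weight structures.** A monoid $(D,+,0)$ is complete if it has sums $\sum_I:D^I\to D$ for all index sets $I$ with $\sum_{\emptyset}=0$, $\sum_{i\in\{k\}}d_i=d_k$, $\sum_{i\in\{j,k\}}d_i=d_j+d_k$ ($j\ne k$), and $\sum_{j\in J}\sum_{i\in I_j}d_i=\sum_{i\in I}d_i$ whenever $I$ is the disjoint union of the $I_j$, $j\in J$. An $\omega$-valuation monoid $(D,+,\mathrm{Val}^\omega,0)$ is a complete monoid with a function $\mathrm{Val}^\omega:D^\omega\to D$ such that $\mathrm{Val}^\omega((d_i)_{i\in\mathbb N})=0$ if some $d_i=0$. An $\omega$-pv-monoid $(D,+,\mathrm{Val}^\omega,\diamond,0,1)$ additionally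 has $1\in D$ and $\diamond:D^2\to D$ with $\mathrm{Val}^\omega(1^\omega)=1$, $0\diamond d=d\diamond 0=0$, $1\diamond d=d\diamond1=d$ for all $d$. It is: - left-$+$-distributive if $d\diamond\sum_{i\in I}d_i=\sum_{i\in I}(d\diamond d_i)$ always (any index set $I$); right-$+$-distributive analogously; $+$-distributive if both; - left-$\mathrm{Val}^\omega$-distributive if $d\diamond\mathrm{Val}^\omega((d_i)_i)=\mathrm{Val}^\omega((d\diamond d_i)_i)$ always; - left-multiplicative if $d\diamond\mathrm{Val}^\omega((d_i)_i)=\mathrm{Val}^\omega(d\diamond d_1,d_2,d_3,\dots)$ always; - left-distributive if left-$+$-distributive and, additionally, left-$\mathrm{Val}^\omega$-distributive or left-multiplicative; - conditionally commutative if for all $(d_i),(d'_i)\in D^\omega$ with $d_i\diamond d'_j=d'_j\diamond d_i$ for all $j<i$: $\mathrm{Val}^\omega((d_i)_i)\diamond\mathrm{Val}^\omega((d'_i)_i)=\mathrm{Val}^\omega((d_i\diamond d'_i)_i)$; - a cc-$\omega$-valuation semiring if $\diamond$ is associative, $D$ is $+$-distributive, conditionally commutative and left-distributive. **Logic $\mathit{MSO}(D,\mathit{NW}(\Sigma))$.** Boolean formulas: $\beta::=\mathrm{Lab}_a(x)\mid \mathrm{call}(x)\mid \mathrm{ret}(x)\mid x\le y\mid\nu(x,y)\mid x\in X\mid\neg\beta\mid\beta\wedge\beta\mid\forall x.\beta\mid\forall X.\beta$. Formulas: $\varphi::=d\mid\beta\mid\varphi\vee\varphi\mid\varphi\wedge\varphi\mid\forall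 x.\varphi\mid\exists x.\varphi\mid\exists X.\varphi$, with $d\in D$, $a\in\Sigma$, $x,y$ first order and $X$ second order variables. **Semantics.** For a finite set $\mathcal V\supseteq\mathrm{free}(\varphi)$ of variables, pairs $(\mathit{nw},\sigma)$, with $\sigma$ assigning positions in $\mathbb N$ to first order and subsets of $\mathbb N$ to second order variables in $\mathcal V$, are encoded as usual as nested $\omega$-words over $\Sigma_{\mathcal V}=\Sigma\times\{0,1\}^{\mathcal V}$ with the same $\nu$; words of $\mathit{NW}^\omega(\Sigma_{\mathcal V})$ that arise from an assignment are called valid. $[\![\varphi]\!]_{\mathcal V}:\mathit{NW}^\omega(\Sigma_{\mathcal V})\to D$ is $0$ on non-valid words, and on valid $(\mathit{nw},\sigma)$: atomic formulas have value $1$ if true (respectively: $a_{\sigma(x)}=a$; $\sigma(x)$ is a call; $\sigma(x)$ is a return; $\sigma(x)\le\sigma(y)$; $\nu(\sigma(x),\sigma(y))$; $\sigma(x)\in\sigma(X)$) and $0$ otherwise; $\neg\beta$ has value $1$ if $\beta$ has value $0$, and $0$ otherwise; $[\![d]\!]=d$; $\vee$ is interpreted by $+$ and $\wedge$ by $\diamond$ of the values; $[\![\exists x.\varphi]\!]_{\mathcal V}(\mathit{nw},\sigma)=\sum_{i\in\mathbb N}[\![\varphi]\!]_{\mathcal V\cup\{x\}}(\mathit{nw},\sigma[x\to i])$; $[\![\exists X.\varphi]\!]_{\mathcal V}(\mathit{nw},\sigma)=\sum_{I\subseteq\mathbb N}[\![\varphi]\!]_{\mathcal V\cup\{X\}}(\mathit{nw},\sigma[X\to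 I])$; $[\![\forall x.\varphi]\!]_{\mathcal V}(\mathit{nw},\sigma)=\mathrm{Val}^\omega(([\![\varphi]\!]_{\mathcal V\cup\{x\}}(\mathit{nw},\sigma[x\to i]))_{i\in\mathbb N})$; $[\![\forall X.\beta]\!]_{\mathcal V}(\mathit{nw},\sigma)=1$ if $[\![\beta]\!]_{\mathcal V\cup\{X\}}(\mathit{nw},\sigma[X\to I])=1$ for all $I\subseteq\mathbb N$, and $0$ otherwise. Put $[\![\varphi]\!]=[\![\varphi]\!]_{\mathrm{free}(\varphi)}$. **Fragments.** Almost boolean formulas: the smallest set of formulas containing all constants $d\in D$ and all boolean formulas and closed under $\vee$ and $\wedge$. $\mathrm{const}(\varphi)$ is the set of elements of $D$ occurring in $\varphi$. The formula $\varphi$ is - strongly-$\wedge$-restricted if for all subformulas $\psi\wedge\theta$: either $\psi$ and $\theta$ are both almost boolean, or $\psi$ is boolean, or $\theta$ is boolean; - $\wedge$-restricted if for all subformulas $\psi\wedge\theta$: $\psi$ is almost boolean or $\theta$ is boolean; - commutatively-$\wedge$-restricted if for all subformulas $\psi\wedge\theta$: $\mathrm{const}(\psi)$ and $\mathrm{const}(\theta)$ commute (i.e. $d\diamond d'=d'\diamond d$ for all $d\in\mathrm{const}(\psi)$, $d'\in\mathrm{const}(\theta)$), or $\psi$ is almost boolean; - $\forall$-restricted if for all subformulas $\forall x.\psi$ ($x$ first order): $\psi$ is almost boolean. *)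

theory Defs
  imports "HOL-Library.FuncSet" "HOL-Library.Disjoint_Sets" "HOL-Library.Extended"
begin

section \<open>Nested \<open>\<omega>\<close>-words\<close>

text \<open>
  Positions are numbered \<open>0, 1, 2, \<dots>\<close> instead of \<open>1, 2, 3, \<dots>\<close>. The type \<open>nat extended\<close> adds
  \<open>Minf\<close> and \<open>Pinf\<close>, standing for \<open>-\<infinity>\<close> and \<open>\<infinity>\<close>, with the expected order.
\<close>

definition matching_relation :: "(nat extended \<times> nat extended) set \<Rightarrow> bool" where
  "matching_relation \<nu> \<longleftrightarrow>
     \<nu> \<subseteq> insert Minf (range Fin) \<times> insert Pinf (range Fin) \<and>
     (\<forall>i j. (i, j) \<in> \<nu> \<longrightarrow> i < j) \<and>
     (\<forall>i::nat. (\<exists>\<^sub>\<le>\<^sub>1 j. (Fin i, j) \<in> \<nu>) \<and> (\<exists>\<^sub>\<le>\<^sub>1 j. (j, Fin i) \<in> \<nu>)) \<and>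
     (\<forall>i j i' j'. (i, j) \<in> \<nu> \<and> (i', j') \<in> \<nu> \<and> i < i' \<longrightarrow> j < i' \<or> j \<ge> j') \<and>
     (Minf, Pinf) \<notin> \<nu>"

type_synonym 'c nested_word = "(nat \<Rightarrow> 'c) \<times> (nat extended \<times> nat extended) set"

definition NW :: "'c set \<Rightarrow> 'c nested_word set" where
  "NW A = {(a, \<nu>). range a \<subseteq> A \<and> matching_relation \<nu>}"

definition is_call :: "'c nested_word \<Rightarrow> nat \<Rightarrow> bool" where
  "is_call nw i \<longleftrightarrow> (\<exists>j. (Fin i, j) \<in> snd nw)"

definition is_return :: "'c nested_word \<Rightarrow> nat \<Rightarrow> bool" where
  "is_return nw j \<longleftrightarrow> (\<exists>i. (i, Fin j) \<in> snd nw)"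


section \<open>Weight structures\<close>

text \<open>
  The carrier is the type \<open>'d\<close>. HOL cannot quantify over index sets of all types within one
  structure, so index sets are all subsets of a type \<open>'i\<close>, which stays an arbitrary parameter and
  plays the role of the universe of index sets. Families are total functions of which only the
  values on the index set matter; this is the reason for the assumption \<open>sum_cong\<close>.
\<close>

record ('d, 'i) pv_struct =
  madd  :: "'d \<Rightarrow> 'd \<Rightarrow> 'd"  (infixl "\<oplus>\<index>" 65)
  mzero :: "'d"  ("\<zero>\<index>")
  msum  :: "'i set \<Rightarrow> ('i \<Rightarrow> 'd) \<Rightarrow> 'd"
  mval  :: "(nat \<Rightarrow> 'd) \<Rightarrow> 'd"
  mdiam :: "'d \<Rightarrow> 'd \<Rightarrow> 'd"  (infixl "\<diamondop>\<index>" 70)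
  mone  :: "'d"  ("\<one>\<index>")

locale complete_monoid =
  fixes D :: "('d, 'i) pv_struct" (structure)
  assumes monoid: "monoid (madd D) \<zero>"
    and sum_cong: "\<And>I d d'. (\<And>i. i \<in> I \<Longrightarrow> d i = d' i) \<Longrightarrow> msum D I d = msum D I d'"
    and sum_empty: "\<And>d. msum D {} d = \<zero>"
    and sum_single: "\<And>k d. msum D {k} d = d k"
    and sum_pair: "\<And>j k d. j \<noteq> k \<Longrightarrow> msum D {j, k} d = d j \<oplus> d k"
    and sum_partition: "\<And>J I d. disjoint_family_on I J \<Longrightarrow>
          msum D J (\<lambda>j. msum D (I j) d) = msum D (\<Union>j\<in>J. I j) d"

locale omega_valuation_monoid = complete_monoid +
  assumes val_zero: "\<And>d k. d k = \<zero> \<Longrightarrow> mval D d = \<zero>"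

locale omega_pv_monoid = omega_valuation_monoid +
  assumes val_one: "mval D (\<lambda>_. \<one>) = \<one>"
    and zero_diam: "\<And>d. \<zero> \<diamondop> d = \<zero>"
    and diam_zero: "\<And>d. d \<diamondop> \<zero> = \<zero>"
    and one_diam: "\<And>d. \<one> \<diamondop> d = d"
    and diam_one: "\<And>d. d \<diamondop> \<one> = d"

definition left_plus_distributive :: "('d, 'i) pv_struct \<Rightarrow> bool" where
  "left_plus_distributive D \<longleftrightarrow>
     (\<forall>d I f. d \<diamondop>\<^bsub>D\<^esub> msum D I f = msum D I (\<lambda>i. d \<diamondop>\<^bsub>D\<^esub> f i))"

definition right_plus_distributive :: "('d, 'i) pv_struct \<Rightarrow> bool" where
  "right_plus_distributive D \<longleftrightarrow>
     (\<forall>d I f. msum D I f \<diamondop>\<^bsub>D\<^esub> d = msum D I (\<lambda>i. f i \<diamondop>\<^bsub>D\<^esub> d))"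

definition plus_distributive :: "('d, 'i) pv_struct \<Rightarrow> bool" where
  "plus_distributive D \<longleftrightarrow> left_plus_distributive D \<and> right_plus_distributive D"

definition left_val_distributive :: "('d, 'i) pv_struct \<Rightarrow> bool" where
  "left_val_distributive D \<longleftrightarrow>
     (\<forall>d f. d \<diamondop>\<^bsub>D\<^esub> mval D f = mval D (\<lambda>i. d \<diamondop>\<^bsub>D\<^esub> f i))"

definition left_multiplicative :: "('d, 'i) pv_struct \<Rightarrow> bool" where
  "left_multiplicative D \<longleftrightarrow>
     (\<forall>d f. d \<diamondop>\<^bsub>D\<^esub> mval D f = mval D (f(0 := d \<diamondop>\<^bsub>D\<^esub> f 0)))"

definition left_distributive :: "('d, 'i) pv_struct \<Rightarrow> bool" where
  "left_distributive D \<longleftrightarrow>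
     left_plus_distributive D \<and> (left_val_distributive D \<or> left_multiplicative D)"

definition conditionally_commutative :: "('d, 'i) pv_struct \<Rightarrow> bool" where
  "conditionally_commutative D \<longleftrightarrow>
     (\<forall>f g. (\<forall>i j. j < i \<longrightarrow> f i \<diamondop>\<^bsub>D\<^esub> g j = g j \<diamondop>\<^bsub>D\<^esub> f i) \<longrightarrow>
        mval D f \<diamondop>\<^bsub>D\<^esub> mval D g = mval D (\<lambda>i. f i \<diamondop>\<^bsub>D\<^esub> g i))"

locale cc_omega_valuation_semiring = omega_pv_monoid +
  assumes diam_assoc: "\<And>a b c. (a \<diamondop> b) \<diamondop> c = a \<diamondop> (b \<diamondop> c)"
    and plus_distributive: "plus_distributive D"
    and conditionally_commutative: "conditionally_commutative D"
    and left_distributive: "left_distributive D"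

text \<open>
  Sums over index sets \<open>J\<close> of another type are transported along an injection of \<open>J\<close> into \<open>'i\<close>.
  In a complete monoid the result does not depend on the chosen injection (lemma \<open>isum_eq\<close>); if
  no injection exists, the value is meaningless.
\<close>

definition isum :: "('d, 'i) pv_struct \<Rightarrow> 'j set \<Rightarrow> ('j \<Rightarrow> 'd) \<Rightarrow> 'd" where
  "isum D J f = (let e = (SOME e :: 'j \<Rightarrow> 'i. inj_on e J) in msum D (e ` J) (f \<circ> inv_into J e))"

lemma (in complete_monoid) msum_reindex:
  assumes "inj_on h J"
  shows "msum D (h ` J) f = msum D J (f \<circ> h)"
proof -
  have "disjoint_family_on (\<lambda>j. {h j}) J"
    using assms by (auto simp: disjoint_family_on_def inj_on_def)
  from sum_partition[OF this, of f] show ?thesis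
    by (simp add: sum_single UNION_singleton_eq_range comp_def)
qed

lemma (in complete_monoid) isum_eq:
  fixes e :: "'j \<Rightarrow> 'i"
  assumes e: "inj_on e J"
  shows "isum D J f = msum D (e ` J) (f \<circ> inv_into J e)"
proof -
  define c where "c = (SOME c :: 'j \<Rightarrow> 'i. inj_on c J)"
  have c: "inj_on c J"
    unfolding c_def by (rule someI[where P = "\<lambda>c. inj_on c J", OF e])
  have "inj_on (e \<circ> inv_into J c) (c ` J)"
    using c e by (auto simp: inj_on_def)
  moreover have "(e \<circ> inv_into J c) ` (c ` J) = e ` J"
    using c by (force simp: image_iff)
  ultimately have "msum D (e ` J) (f \<circ> inv_into J e)
      = msum D (c ` J) ((f \<circ> inv_into J e) \<circ> (e \<circ> inv_into J c))"
    using msum_reindex[of "e \<circ> inv_into J c" "c ` J"] by metis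
  also have "\<dots> = msum D (c ` J) (f \<circ> inv_into J c)"
    using c e by (intro sum_cong) auto
  finally show ?thesis
    by (simp add: isum_def c_def Let_def)
qed


section \<open>The logic\<close>

text \<open>
  First and second order variables are separate copies of the natural numbers. The datatype
  contains all expressions; \<open>boolean\<close> and \<open>MSO\<close> select those generated by the two grammars. The
  set functions \<open>labels\<close> and \<open>constants\<close> give the elements of \<open>\<Sigma>\<close> and \<open>D\<close> that occur.
\<close>

datatype var = FO nat | SO nat

datatype (labels: 'a, constants: 'd) fm =
    Const 'd
  | Lab 'a nat
  | Call nat
  | Ret nat
  | Leq nat nat
  | Match nat nat
  | Elem nat nat
  | Neg "('a, 'd) fm"
  | Or "('a, 'd) fm" "('a, 'd) fm"
  | And "('a, 'd) fm" "('a, 'd) fm"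
  | AllFO nat "('a, 'd) fm"
  | ExFO nat "('a, 'd) fm"
  | AllSO nat "('a, 'd) fm"
  | ExSO nat "('a, 'd) fm"

inductive boolean :: "('a, 'd) fm \<Rightarrow> bool" where
  "boolean (Lab a x)"
| "boolean (Call x)"
| "boolean (Ret x)"
| "boolean (Leq x y)"
| "boolean (Match x y)"
| "boolean (Elem x X)"
| "boolean \<beta> \<Longrightarrow> boolean (Neg \<beta>)"
| "boolean \<beta> \<Longrightarrow> boolean \<gamma> \<Longrightarrow> boolean (And \<beta> \<gamma>)"
| "boolean \<beta> \<Longrightarrow> boolean (AllFO x \<beta>)"
| "boolean \<beta> \<Longrightarrow> boolean (AllSO X \<beta>)"

inductive_set MSO :: "('a, 'd) fm set" where
  "Const d \<in> MSO"
| "boolean \<beta> \<Longrightarrow> \<beta> \<in> MSO"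
| "\<phi> \<in> MSO \<Longrightarrow> \<psi> \<in> MSO \<Longrightarrow> Or \<phi> \<psi> \<in> MSO"
| "\<phi> \<in> MSO \<Longrightarrow> \<psi> \<in> MSO \<Longrightarrow> And \<phi> \<psi> \<in> MSO"
| "\<phi> \<in> MSO \<Longrightarrow> AllFO x \<phi> \<in> MSO"
| "\<phi> \<in> MSO \<Longrightarrow> ExFO x \<phi> \<in> MSO"
| "\<phi> \<in> MSO \<Longrightarrow> ExSO X \<phi> \<in> MSO"

inductive almost_boolean :: "('a, 'd) fm \<Rightarrow> bool" where
  "almost_boolean (Const d)"
| "boolean \<beta> \<Longrightarrow> almost_boolean \<beta>"
| "almost_boolean \<phi> \<Longrightarrow> almost_boolean \<psi> \<Longrightarrow> almost_boolean (Or \<phi> \<psi>)"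
| "almost_boolean \<phi> \<Longrightarrow> almost_boolean \<psi> \<Longrightarrow> almost_boolean (And \<phi> \<psi>)"

primrec free :: "('a, 'd) fm \<Rightarrow> var set" where
  "free (Const d) = {}"
| "free (Lab a x) = {FO x}"
| "free (Call x) = {FO x}"
| "free (Ret x) = {FO x}"
| "free (Leq x y) = {FO x, FO y}"
| "free (Match x y) = {FO x, FO y}"
| "free (Elem x X) = {FO x, SO X}"
| "free (Neg \<phi>) = free \<phi>"
| "free (Or \<phi> \<psi>) = free \<phi> \<union> free \<psi>"
| "free (And \<phi> \<psi>) = free \<phi> \<union> free \<psi>"
| "free (AllFO x \<phi>) = free \<phi> - {FO x}"
| "free (ExFO x \<phi>) = free \<phi> - {FO x}"
| "free (AllSO X \<phi>) = free \<phi> - {SO X}"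
| "free (ExSO X \<phi>) = free \<phi> - {SO X}"

primrec subformulas :: "('a, 'd) fm \<Rightarrow> ('a, 'd) fm set" where
  "subformulas (Const d) = {Const d}"
| "subformulas (Lab a x) = {Lab a x}"
| "subformulas (Call x) = {Call x}"
| "subformulas (Ret x) = {Ret x}"
| "subformulas (Leq x y) = {Leq x y}"
| "subformulas (Match x y) = {Match x y}"
| "subformulas (Elem x X) = {Elem x X}"
| "subformulas (Neg \<phi>) = insert (Neg \<phi>) (subformulas \<phi>)"
| "subformulas (Or \<phi> \<psi>) = insert (Or \<phi> \<psi>) (subformulas \<phi> \<union> subformulas \<psi>)"
| "subformulas (And \<phi> \<psi>) = insert (And \<phi> \<psi>) (subformulas \<phi> \<union> subformulas \<psi>)"
| "subformulas (AllFO x \<phi>) = insert (AllFO x \<phi>) (subformulas \<phi>)"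
| "subformulas (ExFO x \<phi>) = insert (ExFO x \<phi>) (subformulas \<phi>)"
| "subformulas (AllSO X \<phi>) = insert (AllSO X \<phi>) (subformulas \<phi>)"
| "subformulas (ExSO X \<phi>) = insert (ExSO X \<phi>) (subformulas \<phi>)"

definition strongly_and_restricted :: "('a, 'd) fm \<Rightarrow> bool" where
  "strongly_and_restricted \<phi> \<longleftrightarrow>
     (\<forall>\<psi> \<theta>. And \<psi> \<theta> \<in> subformulas \<phi> \<longrightarrow>
        (almost_boolean \<psi> \<and> almost_boolean \<theta>) \<or> boolean \<psi> \<or> boolean \<theta>)"

definition and_restricted :: "('a, 'd) fm \<Rightarrow> bool" where
  "and_restricted \<phi> \<longleftrightarrow>
     (\<forall>\<psi> \<theta>. And \<psi> \<theta> \<in> subformulas \<phi> \<longrightarrow> almost_boolean \<psi> \<or> boolean \<theta>)"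

definition commutatively_and_restricted :: "('d, 'i) pv_struct \<Rightarrow> ('a, 'd) fm \<Rightarrow> bool" where
  "commutatively_and_restricted D \<phi> \<longleftrightarrow>
     (\<forall>\<psi> \<theta>. And \<psi> \<theta> \<in> subformulas \<phi> \<longrightarrow>
        (\<forall>d\<in>constants \<psi>. \<forall>d'\<in>constants \<theta>. d \<diamondop>\<^bsub>D\<^esub> d' = d' \<diamondop>\<^bsub>D\<^esub> d) \<or> almost_boolean \<psi>)"

definition forall_restricted :: "('a, 'd) fm \<Rightarrow> bool" where
  "forall_restricted \<phi> \<longleftrightarrow> (\<forall>x \<psi>. AllFO x \<psi> \<in> subformulas \<phi> \<longrightarrow> almost_boolean \<psi>)"


section \<open>Semantics\<close>

text \<open>
  The value of a formula on a pair of a nested word and an assignment. The assignment is given by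
  total functions \<open>s\<close> (first order) and \<open>S\<close> (second order), of which only the values on the free
  variables matter.
\<close>

primrec sem_at :: "('d, 'i) pv_struct \<Rightarrow> 'a nested_word \<Rightarrow> ('a, 'd) fm \<Rightarrow>
    (nat \<Rightarrow> nat) \<Rightarrow> (nat \<Rightarrow> nat set) \<Rightarrow> 'd" where
  "sem_at D nw (Const d) s S = d"
| "sem_at D nw (Lab a x) s S = (if fst nw (s x) = a then \<one>\<^bsub>D\<^esub> else \<zero>\<^bsub>D\<^esub>)"
| "sem_at D nw (Call x) s S = (if is_call nw (s x) then \<one>\<^bsub>D\<^esub> else \<zero>\<^bsub>D\<^esub>)"
| "sem_at D nw (Ret x) s S = (if is_return nw (s x) then \<one>\<^bsub>D\<^esub> else \<zero>\<^bsub>D\<^esub>)"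
| "sem_at D nw (Leq x y) s S = (if s x \<le> s y then \<one>\<^bsub>D\<^esub> else \<zero>\<^bsub>D\<^esub>)"
| "sem_at D nw (Match x y) s S = (if (Fin (s x), Fin (s y)) \<in> snd nw then \<one>\<^bsub>D\<^esub> else \<zero>\<^bsub>D\<^esub>)"
| "sem_at D nw (Elem x X) s S = (if s x \<in> S X then \<one>\<^bsub>D\<^esub> else \<zero>\<^bsub>D\<^esub>)"
| "sem_at D nw (Neg \<phi>) s S = (if sem_at D nw \<phi> s S = \<zero>\<^bsub>D\<^esub> then \<one>\<^bsub>D\<^esub> else \<zero>\<^bsub>D\<^esub>)"
| "sem_at D nw (Or \<phi> \<psi>) s S = sem_at D nw \<phi> s S \<oplus>\<^bsub>D\<^esub> sem_at D nw \<psi> s S"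
| "sem_at D nw (And \<phi> \<psi>) s S = sem_at D nw \<phi> s S \<diamondop>\<^bsub>D\<^esub> sem_at D nw \<psi> s S"
| "sem_at D nw (AllFO x \<phi>) s S = mval D (\<lambda>i. sem_at D nw \<phi> (s(x := i)) S)"
| "sem_at D nw (ExFO x \<phi>) s S = isum D (UNIV :: nat set) (\<lambda>i. sem_at D nw \<phi> (s(x := i)) S)"
| "sem_at D nw (AllSO X \<phi>) s S =
     (if \<forall>I. sem_at D nw \<phi> s (S(X := I)) = \<one>\<^bsub>D\<^esub> then \<one>\<^bsub>D\<^esub> else \<zero>\<^bsub>D\<^esub>)"
| "sem_at D nw (ExSO X \<phi>) s S =
     isum D (UNIV :: nat set set) (\<lambda>I. sem_at D nw \<phi> s (S(X := I)))"

text \<open>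
  Words over \<open>\<Sigma> \<times> {0,1}\<^sup>V\<close>: the second component of a letter is a function from \<open>V\<close> to \<open>bool\<close>.
  The encoding of a pair marks, in the row of each variable, the positions assigned to it.
\<close>

definition ext_alphabet :: "var set \<Rightarrow> ('a \<times> (var \<Rightarrow> bool)) set" where
  "ext_alphabet V = UNIV \<times> (V \<rightarrow>\<^sub>E UNIV)"

definition encode :: "var set \<Rightarrow> 'a nested_word \<Rightarrow> (nat \<Rightarrow> nat) \<Rightarrow> (nat \<Rightarrow> nat set) \<Rightarrow>
    ('a \<times> (var \<Rightarrow> bool)) nested_word" where
  "encode V nw s S =
     (\<lambda>p. (fst nw p, \<lambda>v\<in>V. case v of FO x \<Rightarrow> p = s x | SO X \<Rightarrow> p \<in> S X), snd nw)"

definition valid :: "var set \<Rightarrow> ('a \<times> (var \<Rightarrow> bool)) nested_word \<Rightarrow> bool" where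
  "valid V w \<longleftrightarrow> (\<exists>nw\<in>NW UNIV. \<exists>s S. w = encode V nw s S)"

definition base_word :: "('a \<times> (var \<Rightarrow> bool)) nested_word \<Rightarrow> 'a nested_word" where
  "base_word w = (fst \<circ> fst w, snd w)"

definition fo_of :: "('a \<times> (var \<Rightarrow> bool)) nested_word \<Rightarrow> nat \<Rightarrow> nat" where
  "fo_of w x = (THE p. snd (fst w p) (FO x))"

definition so_of :: "('a \<times> (var \<Rightarrow> bool)) nested_word \<Rightarrow> nat \<Rightarrow> nat set" where
  "so_of w X = {p. snd (fst w p) (SO X)}"

definition sem :: "('d, 'i) pv_struct \<Rightarrow> var set \<Rightarrow> ('a, 'd) fm \<Rightarrow>
    ('a \<times> (var \<Rightarrow> bool)) nested_word \<Rightarrow> 'd" where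
  "sem D V \<phi> w = (if valid V w then sem_at D (base_word w) \<phi> (fo_of w) (so_of w) else \<zero>\<^bsub>D\<^esub>)"

lemma base_word_encode [simp]: "base_word (encode V nw s S) = nw"
  by (simp add: base_word_def encode_def comp_def prod_eq_iff)

lemma fo_of_encode: "FO x \<in> V \<Longrightarrow> fo_of (encode V nw s S) x = s x"
  by (simp add: fo_of_def encode_def)

lemma so_of_encode: "SO X \<in> V \<Longrightarrow> so_of (encode V nw s S) X = S X"
  by (simp add: so_of_def encode_def)

lemma sem_at_cong:
  "(\<And>x. FO x \<in> free \<phi> \<Longrightarrow> s x = s' x) \<Longrightarrow> (\<And>X. SO X \<in> free \<phi> \<Longrightarrow> S X = S' X) \<Longrightarrow>
    sem_at D nw \<phi> s S = sem_at D nw \<phi> s' S'"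
proof (induction \<phi> arbitrary: s S s' S')
  case (Neg \<phi>)
  from Neg.IH[of s s' S S'] Neg.prems show ?case by simp
next
  case (Or \<phi> \<psi>)
  from Or.IH(1)[of s s' S S'] Or.IH(2)[of s s' S S'] Or.prems show ?case by simp
next
  case (And \<phi> \<psi>)
  from And.IH(1)[of s s' S S'] And.IH(2)[of s s' S S'] And.prems show ?case by simp
next
  case (AllFO x \<phi>)
  have "sem_at D nw \<phi> (s(x := i)) S = sem_at D nw \<phi> (s'(x := i)) S'" for i
    by (rule AllFO.IH) (use AllFO.prems in auto)
  then show ?case by simp
next
  case (ExFO x \<phi>)
  have "sem_at D nw \<phi> (s(x := i)) S = sem_at D nw \<phi> (s'(x := i)) S'" for i
    by (rule ExFO.IH) (use ExFO.prems in auto)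
  then show ?case by simp
next
  case (AllSO X \<phi>)
  have "sem_at D nw \<phi> s (S(X := I)) = sem_at D nw \<phi> s' (S'(X := I))" for I
    by (rule AllSO.IH) (use AllSO.prems in auto)
  then show ?case by simp
next
  case (ExSO X \<phi>)
  have "sem_at D nw \<phi> s (S(X := I)) = sem_at D nw \<phi> s' (S'(X := I))" for I
    by (rule ExSO.IH) (use ExSO.prems in auto)
  then show ?case by simp
qed simp_all

lemma sem_encode:
  assumes "nw \<in> NW UNIV" "free \<phi> \<subseteq> V"
  shows "sem D V \<phi> (encode V nw s S) = sem_at D nw \<phi> s S"
proof -
  have "valid V (encode V nw s S)"
    using assms(1) by (auto simp: valid_def)
  moreover have "sem_at D nw \<phi> (fo_of (encode V nw s S)) (so_of (encode V nw s S))
      = sem_at D nw \<phi> s S"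
    by (rule sem_at_cong) (use assms(2) in \<open>auto simp: fo_of_encode so_of_encode\<close>)
  ultimately show ?thesis by (simp add: sem_def)
qed

text \<open>
  Equality of \<open>\<lbrakk>\<phi>\<rbrakk>\<close> and \<open>\<lbrakk>\<phi>'\<rbrakk>\<close> as functions, including equality of their domains
  \<open>NW (ext_alphabet (free \<phi>))\<close> and \<open>NW (ext_alphabet (free \<phi>'))\<close>.
\<close>

definition same_semantics :: "('d, 'i) pv_struct \<Rightarrow> ('a, 'd) fm \<Rightarrow> ('a, 'd) fm \<Rightarrow> bool" where
  "same_semantics D \<phi> \<phi>' \<longleftrightarrow>
     free \<phi> = free \<phi>' \<and>
     (\<forall>w \<in> NW (ext_alphabet (free \<phi>)). sem D (free \<phi>) \<phi> w = sem D (free \<phi>') \<phi>' w)"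

end

theory Submission
  imports Defs
begin

text \<open>
  A conjunction \<open>\<psi> \<and> \<theta>\<close> with almost boolean \<open>\<psi>\<close> is removed by pushing \<open>\<psi>\<close> into \<open>\<theta>\<close>, down to the
  almost boolean subformulas. Left-distributivity moves \<open>\<psi>\<close> through disjunctions and quantifiers;
  conjunctions in a strongly-\<open>\<and>\<close>-restricted \<open>\<theta>\<close> have a boolean conjunct, whose value \<open>0\<close> or \<open>1\<close> makes
  associativity and commutativity automatic. If \<open>D\<close> is only left-multiplicative, \<open>\<psi> \<and> \<forall>x. \<theta>\<close> becomes
  \<open>\<forall>x. (min(x) \<and> (\<psi> \<and> \<theta>)) \<or> (\<not>min(x) \<and> \<theta>)\<close>. In a cc-\<open>\<omega>\<close>-valuation semiring, commutation of the
  constants of \<open>\<psi>\<close> and \<open>\<theta>\<close> extends to all their values, so either factor can be taken apart first,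
  until two universal quantifiers meet and are merged by conditional commutativity.
\<close>

section \<open>Syntax\<close>

inductive_simps boolean_simps [simp]:
  "boolean (Const d)" "boolean (Lab a x)" "boolean (Call x)" "boolean (Ret x)" "boolean (Leq x y)"
  "boolean (Match x y)" "boolean (Elem x X)" "boolean (Neg \<phi>)" "boolean (Or \<phi> \<psi>)"
  "boolean (And \<phi> \<psi>)" "boolean (AllFO x \<phi>)" "boolean (ExFO x \<phi>)" "boolean (AllSO X \<phi>)"
  "boolean (ExSO X \<phi>)"

inductive_simps MSO_simps:
  "Or \<phi> \<psi> \<in> MSO" "And \<phi> \<psi> \<in> MSO" "AllFO x \<phi> \<in> MSO" "ExFO x \<phi> \<in> MSO"
  "ExSO X \<phi> \<in> MSO"

inductive_simps almost_boolean_cases: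
  "almost_boolean (Const d)" "almost_boolean (Lab a x)" "almost_boolean (Call x)"
  "almost_boolean (Ret x)" "almost_boolean (Leq x y)" "almost_boolean (Match x y)"
  "almost_boolean (Elem x X)" "almost_boolean (Neg \<phi>)" "almost_boolean (Or \<phi> \<psi>)"
  "almost_boolean (And \<phi> \<psi>)" "almost_boolean (AllFO x \<phi>)" "almost_boolean (ExFO x \<phi>)"
  "almost_boolean (AllSO X \<phi>)" "almost_boolean (ExSO X \<phi>)"

lemma almost_boolean_simps [simp]:
  "almost_boolean (Const d)" "almost_boolean (Lab a x)" "almost_boolean (Call x)"
  "almost_boolean (Ret x)" "almost_boolean (Leq x y)" "almost_boolean (Match x y)"
  "almost_boolean (Elem x X)" "almost_boolean (Neg \<phi>) \<longleftrightarrow> boolean \<phi>"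
  "almost_boolean (Or \<phi> \<psi>) \<longleftrightarrow> almost_boolean \<phi> \<and> almost_boolean \<psi>"
  "almost_boolean (And \<phi> \<psi>) \<longleftrightarrow> almost_boolean \<phi> \<and> almost_boolean \<psi>"
  "almost_boolean (AllFO x \<phi>) \<longleftrightarrow> boolean \<phi>" "\<not> almost_boolean (ExFO x \<phi>)"
  "almost_boolean (AllSO X \<phi>) \<longleftrightarrow> boolean \<phi>" "\<not> almost_boolean (ExSO X \<phi>)"
  by (auto simp: almost_boolean_cases intro: almost_boolean.intros(2))

lemma MSO_And [simp]: "And \<phi> \<psi> \<in> MSO \<longleftrightarrow> \<phi> \<in> MSO \<and> \<psi> \<in> MSO"
  and MSO_AllFO [simp]: "AllFO x \<phi> \<in> MSO \<longleftrightarrow> \<phi> \<in> MSO"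
  and MSO_Or [simp]: "Or \<phi> \<psi> \<in> MSO \<longleftrightarrow> \<phi> \<in> MSO \<and> \<psi> \<in> MSO"
  and MSO_ExFO [simp]: "ExFO x \<phi> \<in> MSO \<longleftrightarrow> \<phi> \<in> MSO"
  and MSO_ExSO [simp]: "ExSO X \<phi> \<in> MSO \<longleftrightarrow> \<phi> \<in> MSO"
  by (auto simp: MSO_simps intro: MSO.intros(2))

lemma almost_boolean_MSO: "almost_boolean \<phi> \<Longrightarrow> \<phi> \<in> MSO"
  by (induction rule: almost_boolean.induct) (auto intro: MSO.intros)

lemma boolean_almost_boolean: "boolean \<phi> \<Longrightarrow> almost_boolean \<phi>"
  by (rule almost_boolean.intros)

lemma constants_boolean [simp]: "boolean \<phi> \<Longrightarrow> constants \<phi> = {}"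
  by (induction rule: boolean.induct) auto

lemma finite_free [simp]: "finite (free \<phi>)"
  by (induction \<phi>) auto

lemma self_subformula [simp]: "\<phi> \<in> subformulas \<phi>"
  by (induction \<phi>) auto

section \<open>The restrictions unfolded along the connectives\<close>

lemma strongly_and_restricted_simps [simp]:
  "strongly_and_restricted (Const d)" "strongly_and_restricted (Lab a x)"
  "strongly_and_restricted (Call x)" "strongly_and_restricted (Ret x)"
  "strongly_and_restricted (Leq x y)" "strongly_and_restricted (Match x y)"
  "strongly_and_restricted (Elem x X)"
  "strongly_and_restricted (Neg \<phi>) \<longleftrightarrow> strongly_and_restricted \<phi>"
  "strongly_and_restricted (Or \<phi> \<psi>) \<longleftrightarrow> strongly_and_restricted \<phi> \<and> strongly_and_restricted \<psi>"
  "strongly_and_restricted (And \<phi> \<psi>) \<longleftrightarrow>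
     ((almost_boolean \<phi> \<and> almost_boolean \<psi>) \<or> boolean \<phi> \<or> boolean \<psi>) \<and>
     strongly_and_restricted \<phi> \<and> strongly_and_restricted \<psi>"
  "strongly_and_restricted (AllFO x \<phi>) \<longleftrightarrow> strongly_and_restricted \<phi>"
  "strongly_and_restricted (ExFO x \<phi>) \<longleftrightarrow> strongly_and_restricted \<phi>"
  "strongly_and_restricted (AllSO X \<phi>) \<longleftrightarrow> strongly_and_restricted \<phi>"
  "strongly_and_restricted (ExSO X \<phi>) \<longleftrightarrow> strongly_and_restricted \<phi>"
  by (auto simp: strongly_and_restricted_def)

lemma forall_restricted_simps [simp]:
  "forall_restricted (Const d)" "forall_restricted (Lab a x)"
  "forall_restricted (Call x)" "forall_restricted (Ret x)"
  "forall_restricted (Leq x y)" "forall_restricted (Match x y)"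
  "forall_restricted (Elem x X)"
  "forall_restricted (Neg \<phi>) \<longleftrightarrow> forall_restricted \<phi>"
  "forall_restricted (Or \<phi> \<psi>) \<longleftrightarrow> forall_restricted \<phi> \<and> forall_restricted \<psi>"
  "forall_restricted (And \<phi> \<psi>) \<longleftrightarrow> forall_restricted \<phi> \<and> forall_restricted \<psi>"
  "forall_restricted (AllFO x \<phi>) \<longleftrightarrow> almost_boolean \<phi> \<and> forall_restricted \<phi>"
  "forall_restricted (ExFO x \<phi>) \<longleftrightarrow> forall_restricted \<phi>"
  "forall_restricted (AllSO X \<phi>) \<longleftrightarrow> forall_restricted \<phi>"
  "forall_restricted (ExSO X \<phi>) \<longleftrightarrow> forall_restricted \<phi>"
  by (auto simp: forall_restricted_def)

lemma boolean_restricted: "boolean \<phi> \<Longrightarrow> strongly_and_restricted \<phi> \<and> forall_restricted \<phi>"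
  by (induction rule: boolean.induct) (auto intro: boolean_almost_boolean)

lemma almost_boolean_restricted:
  "almost_boolean \<phi> \<Longrightarrow> strongly_and_restricted \<phi> \<and> forall_restricted \<phi>"
  by (induction rule: almost_boolean.induct) (auto simp: boolean_restricted)

section \<open>Renaming of variables\<close>

text \<open>Bound variables are renamed along with the free ones, so that an injective renaming needs no
  precautions against capture.\<close>

primrec rename :: "(nat \<Rightarrow> nat) \<Rightarrow> (nat \<Rightarrow> nat) \<Rightarrow> ('a, 'd) fm \<Rightarrow> ('a, 'd) fm" where
  "rename f g (Const d) = Const d"
| "rename f g (Lab a x) = Lab a (f x)"
| "rename f g (Call x) = Call (f x)"
| "rename f g (Ret x) = Ret (f x)"
| "rename f g (Leq x y) = Leq (f x) (f y)"
| "rename f g (Match x y) = Match (f x) (f y)"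
| "rename f g (Elem x X) = Elem (f x) (g X)"
| "rename f g (Neg \<phi>) = Neg (rename f g \<phi>)"
| "rename f g (Or \<phi> \<psi>) = Or (rename f g \<phi>) (rename f g \<psi>)"
| "rename f g (And \<phi> \<psi>) = And (rename f g \<phi>) (rename f g \<psi>)"
| "rename f g (AllFO x \<phi>) = AllFO (f x) (rename f g \<phi>)"
| "rename f g (ExFO x \<phi>) = ExFO (f x) (rename f g \<phi>)"
| "rename f g (AllSO X \<phi>) = AllSO (g X) (rename f g \<phi>)"
| "rename f g (ExSO X \<phi>) = ExSO (g X) (rename f g \<phi>)"

lemma size_rename [simp]: "size (rename f g \<phi>) = size \<phi>"
  by (induction \<phi>) auto

lemma constants_rename [simp]: "constants (rename f g \<phi>) = constants \<phi>"
  by (induction \<phi>) auto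

lemma boolean_rename [simp]: "boolean (rename f g \<phi>) \<longleftrightarrow> boolean \<phi>"
  by (induction \<phi>) auto

lemma almost_boolean_rename [simp]: "almost_boolean (rename f g \<phi>) \<longleftrightarrow> almost_boolean \<phi>"
  by (induction \<phi>) auto

lemma MSO_rename [simp]: "\<phi> \<in> MSO \<Longrightarrow> rename f g \<phi> \<in> MSO"
  by (induction rule: MSO.induct) (auto intro: MSO.intros)

lemma strongly_and_restricted_rename [simp]:
  "strongly_and_restricted (rename f g \<phi>) \<longleftrightarrow> strongly_and_restricted \<phi>"
  by (induction \<phi>) auto

lemma forall_restricted_rename [simp]:
  "forall_restricted (rename f g \<phi>) \<longleftrightarrow> forall_restricted \<phi>"
  by (induction \<phi>) auto

text \<open>For injective \<open>h\<close>, updating an assignment at \<open>h x\<close> and then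
  composing with \<open>h\<close> is the same as composing first and updating at \<open>x\<close>.
  This carries the induction through the binders.\<close>

lemma sem_at_rename:
  assumes "inj f" "inj g"
  shows "sem_at D nw (rename f g \<phi>) s S = sem_at D nw \<phi> (s \<circ> f) (S \<circ> g)"
proof -
  have upd: "t(h x := i) \<circ> h = (t \<circ> h)(x := i)" if "inj h" 
    for h :: "nat \<Rightarrow> nat" and t :: "nat \<Rightarrow> 'e" and x i
    using that by (auto simp: fun_eq_iff inj_eq)
  show ?thesis
    by (induction \<phi> arbitrary: s S) (simp_all add: upd assms)
qed

lemma free_rename:
  assumes "inj f" "inj g"
  shows "free (rename f g \<phi>) = case_var (FO \<circ> f) (SO \<circ> g) ` free \<phi>" (is "_ = ?h ` _")
proof -
  have "?h (FO x) = FO (f x)" "?h (SO x) = SO (g x)" for x by simp_all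
  moreover have "inj ?h"
  proof (rule injI)
    fix u v assume "?h u = ?h v"
    then show "u = v"
      using assms by (cases u; cases v) (simp_all add: inj_eq)
  qed
  \<comment> \<open>The binder cases remove a variable, and only an injective image commutes with
    set difference in general.\<close>
  then have "?h ` (A - {v}) = ?h ` A - {?h v}" for A v
    by (simp add: image_set_diff)
  ultimately show ?thesis
    by (induction \<phi>) (simp_all only: free.simps rename.simps image_Un image_insert image_empty)
qed

text \<open>A transposition instead of a substitution of \<open>y\<close> for \<open>x\<close>: it
  is injective, so \<open>y\<close> may even occur bound in the formula.\<close>

abbreviation swap_FO :: "nat \<Rightarrow> nat \<Rightarrow> ('a, 'd) fm \<Rightarrow> ('a, 'd) fm" where
  "swap_FO x y \<equiv> rename (id(x := y, y := x)) id"

abbreviation swap_SO :: "nat \<Rightarrow> nat \<Rightarrow> ('a, 'd) fm \<Rightarrow> ('a, 'd) fm" where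
  "swap_SO x y \<equiv> rename id (id(x := y, y := x))"

lemma inj_swap: "inj (id(x := y, y := x))"
  by (auto simp: inj_def)

text \<open>Together with \<open>sem_at_swap_FO\<close> this is alpha-conversion: a quantifier over
  \<open>x\<close> may be replaced by one over \<open>y\<close>.\<close>

lemma free_swap_FO: "FO y \<notin> free \<phi> \<Longrightarrow> free (swap_FO x y \<phi>) - {FO y} = free \<phi> - {FO x}"
  by (subst free_rename) (force simp: inj_swap image_iff split: var.splits if_splits)+

lemma free_swap_SO: "SO y \<notin> free \<phi> \<Longrightarrow> free (swap_SO x y \<phi>) - {SO y} = free \<phi> - {SO x}"
  by (subst free_rename) (force simp: inj_swap image_iff split: var.splits if_splits)+

text \<open>After the swap the assignments can differ only at \<open>y\<close>, which is not free in
  \<phi>.\<close>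

lemma sem_at_swap_FO:
  "FO y \<notin> free \<phi> \<Longrightarrow> sem_at D nw (swap_FO x y \<phi>) (s(y := i)) S = sem_at D nw \<phi> (s(x := i)) S"
  by (subst sem_at_rename) (auto simp: inj_swap intro!: sem_at_cong)

lemma sem_at_swap_SO:
  assumes "SO y \<notin> free \<phi>"
  shows "sem_at D nw (swap_SO x y \<phi>) s (S(y := I)) = sem_at D nw \<phi> s (S(x := I))"
proof -
  have "(S(y := I) \<circ> id(x := y, y := x)) X = (S(x := I)) X" if "X \<noteq> y" for X
    using that by (cases "X = x") simp_all
  then have "sem_at D nw \<phi> s (S(y := I) \<circ> id(x := y, y := x)) = sem_at D nw \<phi> s (S(x := I))"
    using assms by (intro sem_at_cong refl) metis
  then show ?thesis by (simp add: sem_at_rename inj_swap)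
qed

lemma sem_at_fresh_FO [simp]:
  "FO y \<notin> free \<phi> \<Longrightarrow> sem_at D nw \<phi> (s(y := i)) S = sem_at D nw \<phi> s S"
  by (rule sem_at_cong) auto

lemma sem_at_fresh_SO [simp]:
  "SO y \<notin> free \<phi> \<Longrightarrow> sem_at D nw \<phi> s (S(y := I)) = sem_at D nw \<phi> s S"
  by (rule sem_at_cong) auto

section \<open>Choice of fresh variables\<close>

lemma fresh_FO:
  assumes "finite F"
  obtains y where "FO y \<notin> F"
proof -
  have "finite (FO -` F)"
    using assms by (intro finite_vimageI) (auto simp: inj_def)
  then show ?thesis
    using that ex_new_if_finite[OF infinite_UNIV_nat] by auto
qed

lemma fresh_SO:
  assumes "finite F"
  obtains y where "SO y \<notin> F"
proof -
  have "finite (SO -` F)"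
    using assms by (intro finite_vimageI) (auto simp: inj_def)
  then show ?thesis
    using that ex_new_if_finite[OF infinite_UNIV_nat] by auto
qed

section \<open>Normalizable formulas\<close>

text \<open>The clause on constants keeps commutativity conditions intact when subformulas are replaced.\<close>

definition equivalent :: "('d, 'i) pv_struct \<Rightarrow> ('a, 'd) fm \<Rightarrow> ('a, 'd) fm \<Rightarrow> bool" where
  "equivalent D \<phi> \<phi>' \<longleftrightarrow> free \<phi>' = free \<phi> \<and> constants \<phi>' \<subseteq> constants \<phi> \<and>
     (forall_restricted \<phi> \<longrightarrow> forall_restricted \<phi>') \<and>
     (\<forall>nw s S. sem_at D nw \<phi>' s S = sem_at D nw \<phi> s S)"

definition normalizable :: "('d, 'i) pv_struct \<Rightarrow> ('a, 'd) fm \<Rightarrow> bool" where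
  "normalizable D \<phi> \<longleftrightarrow> (\<exists>\<phi>'\<in>MSO. strongly_and_restricted \<phi>' \<and> equivalent D \<phi> \<phi>')"

text \<open>Equal free variables give the same valid words; on these \<open>sem\<close> is an
  instance of \<open>sem_at\<close>, and elsewhere it is zero.\<close>

lemma equivalent_same_semantics: "equivalent D \<phi> \<phi>' \<Longrightarrow> same_semantics D \<phi> \<phi>'"
  by (simp add: equivalent_def same_semantics_def sem_def del: split_paired_All)

lemma equivalent_trans: "equivalent D \<phi> \<psi> \<Longrightarrow> equivalent D \<psi> \<chi> \<Longrightarrow> equivalent D \<phi> \<chi>"
  by (auto simp: equivalent_def)

lemma equivalent_And:
  "equivalent D \<phi> \<phi>' \<Longrightarrow> equivalent D \<psi> \<psi>' \<Longrightarrow> equivalent D (And \<phi> \<psi>) (And \<phi>' \<psi>')"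
  by (auto simp: equivalent_def)

lemma normalizable_equivalent: "equivalent D \<phi> \<psi> \<Longrightarrow> normalizable D \<psi> \<Longrightarrow> normalizable D \<phi>"
  by (auto simp: normalizable_def intro: equivalent_trans)

lemma normalizable_self: "\<phi> \<in> MSO \<Longrightarrow> strongly_and_restricted \<phi> \<Longrightarrow> normalizable D \<phi>"
  by (auto simp: normalizable_def equivalent_def)

lemma normalizable_almost_boolean: "almost_boolean \<phi> \<Longrightarrow> normalizable D \<phi>"
  by (simp add: normalizable_self almost_boolean_MSO almost_boolean_restricted)

lemma normalizable_Or:
  assumes "normalizable D \<phi>" "normalizable D \<psi>"
  shows "normalizable D (Or \<phi> \<psi>)"
proof -
  obtain \<phi>' \<psi>' where "\<phi>' \<in> MSO" "strongly_and_restricted \<phi>'" "equivalent D \<phi> \<phi>'"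
    "\<psi>' \<in> MSO" "strongly_and_restricted \<psi>'" "equivalent D \<psi> \<psi>'"
    using assms by (auto simp: normalizable_def)
  then show ?thesis
    unfolding normalizable_def by (intro bexI[where x = "Or \<phi>' \<psi>'"]) (auto simp: equivalent_def)
qed

lemma normalizable_boolean_And:
  "boolean \<beta> \<Longrightarrow> normalizable D \<phi> \<Longrightarrow> normalizable D (And \<beta> \<phi>)"
  unfolding normalizable_def
  by (elim bexE, rule bexI[where x = "And \<beta> _"])
    (auto simp: equivalent_def boolean_restricted MSO.intros(2))

lemma normalizable_And_boolean:
  "boolean \<beta> \<Longrightarrow> normalizable D \<phi> \<Longrightarrow> normalizable D (And \<phi> \<beta>)"
  unfolding normalizable_def
  by (elim bexE, rule bexI[where x = "And _ \<beta>"])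
    (auto simp: equivalent_def boolean_restricted MSO.intros(2))

lemma normalizable_ExFO: "normalizable D \<phi> \<Longrightarrow> normalizable D (ExFO x \<phi>)"
  unfolding normalizable_def
  by (elim bexE, rule bexI[where x = "ExFO x _"]) (auto simp: equivalent_def)

lemma normalizable_ExSO: "normalizable D \<phi> \<Longrightarrow> normalizable D (ExSO X \<phi>)"
  unfolding normalizable_def
  by (elim bexE, rule bexI[where x = "ExSO X _"]) (auto simp: equivalent_def)

lemma normalizable_AllFO:
  assumes "normalizable D \<phi>"
  shows "normalizable D (AllFO x \<phi>)"
proof (cases "almost_boolean \<phi>")
  \<comment> \<open>A normal form of an almost boolean \<phi> need not be almost boolean, and
    replacing \<phi> could destroy \<forall>-restriction; so the formula is kept as it
    stands.\<close>
  case True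
  then show ?thesis
    by (intro normalizable_self) (simp_all add: almost_boolean_MSO almost_boolean_restricted)
next
  \<comment> \<open>Now \<open>AllFO x \<phi>\<close> is not \<forall>-restricted, so that clause of
    \<open>equivalent\<close> holds vacuously.\<close>
  case False
  with assms show ?thesis
    unfolding normalizable_def
    by (elim bexE, intro bexI[where x = "AllFO x _"]) (auto simp: equivalent_def)
qed

section \<open>Conjunctions with almost boolean formulas\<close>

context omega_pv_monoid
begin

lemma add_zero [simp]: "d \<oplus> \<zero> = d" "\<zero> \<oplus> d = d"
  using monoid by (simp_all add: monoid.axioms(2) monoid.left_neutral monoid.right_neutral)

declare zero_diam [simp] diam_zero [simp] one_diam [simp] diam_one [simp]

lemma boolean_value: "boolean \<beta> \<Longrightarrow> sem_at D nw \<beta> s S = \<zero> \<or> sem_at D nw \<beta> s S = \<one>"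
proof (induction arbitrary: s S rule: boolean.induct)
  case (9 \<beta> x)
  show ?case
  \<comment> \<open>A single zero annihilates the valuation; otherwise the family is constantly one
    and \<open>val_one\<close> applies.\<close>
  proof (cases "\<exists>i. sem_at D nw \<beta> (s(x := i)) S = \<zero>")
    case True
    then show ?thesis using val_zero by force
  next
    case False
    with 9 have "(\<lambda>i. sem_at D nw \<beta> (s(x := i)) S) = (\<lambda>_. \<one>)" by blast
    then show ?thesis using val_one by simp
  qed
next
  case (8 \<beta> \<gamma>)
  from 8(3)[of s S] 8(4)[of s S] show ?case by auto
qed auto

lemma diam_boolean_left_commute:
  assumes "boolean \<beta>"
  shows "d \<diamondop> (sem_at D nw \<beta> s S \<diamondop> e) = sem_at D nw \<beta> s S \<diamondop> (d \<diamondop> e)"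
  using boolean_value[OF assms, of nw s S] by auto

lemma diam_boolean_assoc:
  assumes "boolean \<beta>"
  shows "d \<diamondop> (e \<diamondop> sem_at D nw \<beta> s S) = (d \<diamondop> e) \<diamondop> sem_at D nw \<beta> s S"
  using boolean_value[OF assms, of nw s S] by auto

lemma diam_boolean_right_commute:
  assumes "boolean \<beta>"
  shows "(d \<diamondop> sem_at D nw \<beta> s S) \<diamondop> e = (d \<diamondop> e) \<diamondop> sem_at D nw \<beta> s S"
  using boolean_value[OF assms, of nw s S] by auto

lemma boolean_diam_commute:
  "boolean \<beta> \<Longrightarrow> sem_at D nw \<beta> s S \<diamondop> d = d \<diamondop> sem_at D nw \<beta> s S"
  using boolean_value[of \<beta> nw s S] by auto

end

text \<open>This is min(x), with an auxiliary bound variable \<open>y\<close> that has to differ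
  from \<open>x\<close>.\<close>

definition first_position :: "nat \<Rightarrow> nat \<Rightarrow> ('a, 'd) fm" where
  "first_position x y = AllFO y (Leq x y)"

lemma boolean_first_position [simp]: "boolean (first_position x y)"
  by (simp add: first_position_def)

lemma free_first_position [simp]: "x \<noteq> y \<Longrightarrow> free (first_position x y) = {FO x}"
  by (auto simp: first_position_def)

lemma (in omega_pv_monoid) sem_first_position [simp]:
  assumes "x \<noteq> y"
  shows "sem_at D nw (first_position x y) s S = (if s x = 0 then \<one> else \<zero>)"
proof (cases "s x = 0")
  case True
  then show ?thesis
    using assms by (simp add: first_position_def val_one)
next
  case False
  \<comment> \<open>The position 0 for \<open>y\<close> refutes \<open>Leq x y\<close>, which makes
    the valuation zero.\<close>
  then show ?thesis
    using assms by (auto simp: first_position_def intro!: val_zero[where k = 0])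
qed

text \<open>Binary addition is tied to \<open>msum\<close> through index sets with two elements. Two
  distinct indices therefore let distributivity over \<open>msum\<close> pass to \<oplus>.\<close>

locale left_distributive_pv_monoid = omega_pv_monoid D for D :: "('d, 'i) pv_struct" (structure) +
  assumes left_distributive: "left_distributive D"
    and two_indices: "\<exists>j k :: 'i. j \<noteq> k"
begin

text \<open>Both sides are \<open>msum\<close> along the same chosen map, so distributivity over
  \<open>msum\<close> applies directly.\<close>

lemma diam_isum: "d \<diamondop> isum D J f = isum D J (\<lambda>i. d \<diamondop> f i)"
  using left_distributive
  by (simp add: left_distributive_def left_plus_distributive_def isum_def Let_def comp_def)

lemma diam_add: "d \<diamondop> (a \<oplus> b) = (d \<diamondop> a) \<oplus> (d \<diamondop> b)"
proof -
  obtain j k :: 'i where "j \<noteq> k" using two_indices by blast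
  define f where "f i = (if i = j then a else b)" for i
  have "d \<diamondop> msum D {j, k} f = msum D {j, k} (\<lambda>i. d \<diamondop> f i)"
    using left_distributive by (simp add: left_distributive_def left_plus_distributive_def)
  with \<open>j \<noteq> k\<close> show ?thesis by (simp add: sum_pair f_def)
qed

text \<open>Since \<open>x\<close> is not free in \<psi>, the value of \<psi> is a constant factor
  in front of the valuation. The last assumption is what the induction on \<theta> will
  supply.\<close>

lemma normalizable_almost_boolean_And_AllFO:
  fixes \<psi> \<theta> :: "('a, 'd) fm"
  assumes "almost_boolean \<psi>" "\<theta> \<in> MSO" "strongly_and_restricted \<theta>"
    and "FO x \<notin> free \<psi>" "normalizable D (And \<psi> \<theta>)"
  shows "normalizable D (And \<psi> (AllFO x \<theta>))"
  using left_distributive unfolding left_distributive_def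
proof (elim conjE disjE)
  assume "left_val_distributive D"
  then have "equivalent D (And \<psi> (AllFO x \<theta>)) (AllFO x (And \<psi> \<theta>))"
    using assms by (auto simp: equivalent_def left_val_distributive_def)
  then show ?thesis
    using assms(5) by (rule normalizable_equivalent[OF _ normalizable_AllFO])
next
  assume mult: "left_multiplicative D"
  define \<beta> :: "('a, 'd) fm" where "\<beta> = first_position x (Suc x)"
  \<comment> \<open>The two disjuncts exclude each other, so the factor \<psi> enters at position 0
    only, as left-multiplicativity demands.\<close>
  define \<chi> where "\<chi> = Or (And \<beta> (And \<psi> \<theta>)) (And (Neg \<beta>) \<theta>)"
  have [simp]: "boolean \<beta>" "free \<beta> = {FO x}" "constants \<beta> = {}"
    by (simp_all add: \<beta>_def)
  have val: "(\<lambda>i. sem_at D nw \<chi> (s(x := i)) S) =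
      (\<lambda>i. sem_at D nw \<theta> (s(x := i)) S)(0 := sem_at D nw \<psi> s S \<diamondop> sem_at D nw \<theta> (s(x := 0)) S)"
    for nw s S
    using assms(4) by (auto simp: \<chi>_def \<beta>_def)
  have "equivalent D (And \<psi> (AllFO x \<theta>)) (AllFO x \<chi>)"
    unfolding equivalent_def
  proof (intro conjI allI impI)
    fix nw s S
    show "sem_at D nw (AllFO x \<chi>) s S = sem_at D nw (And \<psi> (AllFO x \<theta>)) s S"
      using mult by (simp add: val left_multiplicative_def)
  \<comment> \<open>If \<theta> is almost boolean, so is \<chi>, because \<psi> is; hence
    \<forall>-restriction survives.\<close>
  qed (use assms(1,4) in \<open>auto simp: \<chi>_def boolean_almost_boolean boolean_restricted\<close>)
  moreover have "normalizable D \<chi>"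
    using assms unfolding \<chi>_def
    by (intro normalizable_Or normalizable_boolean_And[of \<beta>] normalizable_boolean_And[of "Neg \<beta>"]
        normalizable_self[of \<theta>]) auto
  ultimately show ?thesis
    by (rule normalizable_equivalent[OF _ normalizable_AllFO])
qed

lemma normalizable_almost_boolean_And:
  assumes "almost_boolean \<psi>" "\<theta> \<in> MSO" "strongly_and_restricted \<theta>"
  shows "normalizable D (And \<psi> \<theta>)"
  using assms(2,3)
\<comment> \<open>Induction on the size, because the hypothesis is also applied to renamed copies of
  subformulas.\<close>
proof (induction "size \<theta>" arbitrary: \<theta> rule: less_induct)
  case less
  note IH = less(1)
  show ?case
  proof (cases "almost_boolean \<theta>")
    case True
    with assms(1) show ?thesis by (intro normalizable_almost_boolean) simp
  next
    case not_ab: False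
    from less(2) show ?thesis
    proof cases
      case (1 d)
      then show ?thesis using not_ab by simp
    next
      case 2
      then show ?thesis using not_ab by (simp add: boolean_almost_boolean)
    next
      case (3 a b)
      have "equivalent D (And \<psi> \<theta>) (Or (And \<psi> a) (And \<psi> b))"
        by (auto simp: 3 equivalent_def diam_add)
      with IH[of a] IH[of b] less(3) 3 show ?thesis
        by (auto intro!: normalizable_Or elim!: normalizable_equivalent)
    next
      case (4 a b)
      \<comment> \<open>As \<theta> is not almost boolean, its conjuncts are not both almost
        boolean, and strong \<and>-restriction leaves a boolean one.\<close>
      with less(3) not_ab consider "boolean a" | "boolean b" by auto
      then show ?thesis
      proof cases
        case 1
        have "equivalent D (And \<psi> \<theta>) (And a (And \<psi> b))"
          by (auto simp: 4 equivalent_def diam_boolean_left_commute[OF 1])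
        with IH[of b] less(3) 4 1 show ?thesis
          by (auto intro!: normalizable_boolean_And elim!: normalizable_equivalent)
      next
        case 2
        have "equivalent D (And \<psi> \<theta>) (And (And \<psi> a) b)"
          by (auto simp: 4 equivalent_def diam_boolean_assoc[OF 2])
        with IH[of a] less(3) 4 2 show ?thesis
          by (auto intro!: normalizable_And_boolean elim!: normalizable_equivalent)
      qed
    next
      case (5 a x)
      \<comment> \<open>Freshness for \<open>a\<close> permits alpha-conversion; freshness for
        \<psi> permits moving \<psi> under the quantifier.\<close>
      obtain y where y: "FO y \<notin> free \<psi> \<union> free a"
        using fresh_FO[of "free \<psi> \<union> free a"] by auto
      have "equivalent D (And \<psi> \<theta>) (And \<psi> (AllFO y (swap_FO x y a)))"
        using y by (simp add: 5 equivalent_def free_swap_FO sem_at_swap_FO)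
      moreover have "normalizable D (And \<psi> (AllFO y (swap_FO x y a)))"
        using y less(3) 5 IH[of "swap_FO x y a"]
        by (intro normalizable_almost_boolean_And_AllFO assms(1)) auto
      ultimately show ?thesis by (rule normalizable_equivalent)
    next
      case (6 a x)
      obtain y where y: "FO y \<notin> free \<psi> \<union> free a"
        using fresh_FO[of "free \<psi> \<union> free a"] by auto
      have "equivalent D (And \<psi> \<theta>) (ExFO y (And \<psi> (swap_FO x y a)))"
        using y by (simp add: 6 equivalent_def free_swap_FO sem_at_swap_FO Un_Diff diam_isum)
      then show ?thesis
        using IH[of "swap_FO x y a"] less(3) 6
        by (auto intro!: normalizable_ExFO elim!: normalizable_equivalent)
    next
      case (7 a X)
      obtain Y where Y: "SO Y \<notin> free \<psi> \<union> free a"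
        using fresh_SO[of "free \<psi> \<union> free a"] by auto
      have "equivalent D (And \<psi> \<theta>) (ExSO Y (And \<psi> (swap_SO X Y a)))"
        using Y by (simp add: 7 equivalent_def free_swap_SO sem_at_swap_SO Un_Diff diam_isum)
      then show ?thesis
        using IH[of "swap_SO X Y a"] less(3) 7
        by (auto intro!: normalizable_ExSO elim!: normalizable_equivalent)
    qed
  qed
qed

end

section \<open>Conjunctions with commuting constants\<close>

locale cc_semiring = cc_omega_valuation_semiring D for D :: "('d, 'i) pv_struct" (structure) +
  assumes two_indices: "\<exists>j k :: 'i. j \<noteq> k"

sublocale cc_semiring \<subseteq> left_distributive_pv_monoid
  by unfold_locales (fact left_distributive two_indices)+

context cc_semiring
begin

lemma isum_diam: "isum D J f \<diamondop> d = isum D J (\<lambda>i. f i \<diamondop> d)"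
  using plus_distributive
  by (simp add: plus_distributive_def right_plus_distributive_def isum_def Let_def comp_def)

lemma add_diam: "(a \<oplus> b) \<diamondop> d = (a \<diamondop> d) \<oplus> (b \<diamondop> d)"
proof -
  obtain j k :: 'i where "j \<noteq> k" using two_indices by blast
  define f where "f i = (if i = j then a else b)" for i
  have "msum D {j, k} f \<diamondop> d = msum D {j, k} (\<lambda>i. f i \<diamondop> d)"
    using plus_distributive by (simp add: plus_distributive_def right_plus_distributive_def)
  with \<open>j \<noteq> k\<close> show ?thesis by (simp add: sum_pair f_def)
qed

lemma mval_diam_mval:
  assumes "\<And>i j. f i \<diamondop> g j = g j \<diamondop> f i"
  shows "mval D f \<diamondop> mval D g = mval D (\<lambda>i. f i \<diamondop> g i)"
  using conditionally_commutative assms by (simp add: conditionally_commutative_def)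

text \<open>Conditional commutativity applies because either variant of left-distributivity writes
  \<open>e\<close> as a valuation: of \<open>(e, e, \<dots>)\<close> or of \<open>(e, \<one>, \<one>, \<dots>)\<close>.\<close>

lemma mval_commute:
  assumes comm: "\<And>i. e \<diamondop> f i = f i \<diamondop> e"
  shows "e \<diamondop> mval D f = mval D f \<diamondop> e"
  using left_distributive unfolding left_distributive_def
proof (elim conjE disjE)
  assume "left_val_distributive D"
  then have dist: "d \<diamondop> mval D g = mval D (\<lambda>i. d \<diamondop> g i)" for d g
    by (simp add: left_val_distributive_def)
  have "e = mval D (\<lambda>_. e)"
    using dist[of e "\<lambda>_. \<one>"] by (simp add: val_one)
  then have "mval D f \<diamondop> e = mval D f \<diamondop> mval D (\<lambda>_. e)" by simp
  also have "\<dots> = mval D (\<lambda>i. f i \<diamondop> e)"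
    by (rule mval_diam_mval) (simp add: comm)
  finally show ?thesis by (simp add: dist comm)
next
  assume "left_multiplicative D"
  then have dist: "d \<diamondop> mval D g = mval D (g(0 := d \<diamondop> g 0))" for d g
    by (simp add: left_multiplicative_def)
  define g where "g = (\<lambda>_::nat. \<one>)(0 := e)"
  have "e = mval D g"
    using dist[of e "\<lambda>_. \<one>"] by (simp add: val_one g_def)
  then have "mval D f \<diamondop> e = mval D f \<diamondop> mval D g" by simp
  also have "\<dots> = mval D (\<lambda>i. f i \<diamondop> g i)"
    by (rule mval_diam_mval) (simp add: comm g_def)
  also have "\<dots> = mval D (f(0 := e \<diamondop> f 0))"
    by (rule arg_cong[where f = "mval D"]) (auto simp: g_def comm)
  finally show ?thesis by (simp add: dist)
qed

text \<open>The elements commuting with \<open>e\<close> include zero and one and are closed under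
  products, the sums that occur, and valuations, so the property spreads from the constants by
  induction.\<close>

lemma commute_with_value:
  assumes "\<phi> \<in> MSO" "\<And>d. d \<in> constants \<phi> \<Longrightarrow> e \<diamondop> d = d \<diamondop> e"
  shows "e \<diamondop> sem_at D nw \<phi> s S = sem_at D nw \<phi> s S \<diamondop> e"
  using assms
proof (induction arbitrary: s S rule: MSO.induct)
  case (2 \<beta>)
  then show ?case by (simp add: boolean_diam_commute)
next
  case (4 \<phi> \<psi>)
  let ?a = "sem_at D nw \<phi> s S" and ?b = "sem_at D nw \<psi> s S"
  have "e \<diamondop> ?a = ?a \<diamondop> e" "e \<diamondop> ?b = ?b \<diamondop> e"
    using 4 by simp_all
  then have "e \<diamondop> (?a \<diamondop> ?b) = (?a \<diamondop> ?b) \<diamondop> e"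
    by (metis diam_assoc)
  then show ?case by simp
next
  case (5 \<phi> x)
  then show ?case by (simp add: mval_commute)
qed (simp_all add: diam_add add_diam diam_isum isum_diam)

definition constants_commute :: "('a, 'd) fm \<Rightarrow> ('a, 'd) fm \<Rightarrow> bool" where
  "constants_commute \<psi> \<theta> \<longleftrightarrow> (\<forall>d\<in>constants \<psi>. \<forall>d'\<in>constants \<theta>. d \<diamondop> d' = d' \<diamondop> d)"

lemma constants_commute_sym: "constants_commute \<psi> \<theta> \<Longrightarrow> constants_commute \<theta> \<psi>"
  by (auto simp: constants_commute_def)

lemma constants_commute_mono:
  "constants_commute \<psi> \<theta> \<Longrightarrow> constants \<psi>' \<subseteq> constants \<psi> \<Longrightarrow> constants \<theta>' \<subseteq> constants \<theta> \<Longrightarrow>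
    constants_commute \<psi>' \<theta>'"
  by (auto simp: constants_commute_def)

text \<open>Two applications of \<open>commute_with_value\<close>: first each constant of \<theta>
  commutes with the values of \<psi>, then each value of \<psi> with those of \<theta>. The
  assignments may differ, as merging two valuations compares values at different positions.\<close>

lemma values_commute:
  assumes "\<psi> \<in> MSO" "\<theta> \<in> MSO" "constants_commute \<psi> \<theta>"
  shows "sem_at D nw \<psi> s S \<diamondop> sem_at D nw \<theta> s' S' = sem_at D nw \<theta> s' S' \<diamondop> sem_at D nw \<psi> s S"
proof (rule commute_with_value[OF assms(2)])
  fix d assume "d \<in> constants \<theta>"
  then show "sem_at D nw \<psi> s S \<diamondop> d = d \<diamondop> sem_at D nw \<psi> s S"
    using assms(3) by (intro commute_with_value[OF assms(1), symmetric])
      (auto simp: constants_commute_def)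
qed

lemma equivalent_And_commute:
  "\<psi> \<in> MSO \<Longrightarrow> \<theta> \<in> MSO \<Longrightarrow> constants_commute \<psi> \<theta> \<Longrightarrow> equivalent D (And \<psi> \<theta>) (And \<theta> \<psi>)"
  using values_commute[of \<psi> \<theta>] by (auto simp: equivalent_def)

lemma normalizable_commuting_And:
  fixes \<psi> \<theta> :: "('a, 'd) fm"
  assumes "\<psi> \<in> MSO" "strongly_and_restricted \<psi>" "\<theta> \<in> MSO" "strongly_and_restricted \<theta>"
    and "constants_commute \<psi> \<theta>"
  shows "normalizable D (And \<psi> \<theta>)"
  using assms
\<comment> \<open>The sum of the sizes is symmetric, so either conjunct may be the one taken
  apart.\<close>
proof (induction "size \<psi> + size \<theta>" arbitrary: \<psi> \<theta> rule: less_induct)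
  case less
  note IH = less(1)
  \<comment> \<open>Stated for any pair of the same total size, so that it serves \<psi> and
    \<theta> in both orders. It decomposes the left conjunct by right-distributivity and leaves out
    universal quantifiers, which right-distributivity over sums does not cover.\<close>
  have left: "normalizable D (And \<alpha> \<beta>)"
    if hyps: "\<alpha> \<in> MSO" "strongly_and_restricted \<alpha>" "\<beta> \<in> MSO" "strongly_and_restricted \<beta>"
      "constants_commute \<alpha> \<beta>"
    and size: "size \<alpha> + size \<beta> = size \<psi> + size \<theta>"
    and not_AllFO: "\<And>x a. \<alpha> \<noteq> AllFO x a" for \<alpha> \<beta> :: "('a, 'd) fm"
  proof (cases "almost_boolean \<alpha>")
    case True
    with hyps show ?thesis by (intro normalizable_almost_boolean_And)
  next
    case not_ab: False
    have IH': "normalizable D (And a \<beta>)"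
      if "size a < size \<alpha>" "a \<in> MSO" "strongly_and_restricted a" "constants a \<subseteq> constants \<alpha>" for a
      using that hyps size by (intro IH constants_commute_mono[OF hyps(5)]) simp_all
    from hyps(1) show ?thesis
    proof cases
      case (1 d)
      then show ?thesis using not_ab by simp
    next
      case 2
      then show ?thesis using not_ab by (simp add: boolean_almost_boolean)
    next
      case (3 a b)
      have "equivalent D (And \<alpha> \<beta>) (Or (And a \<beta>) (And b \<beta>))"
        by (auto simp: 3 equivalent_def add_diam)
      with IH'[of a] IH'[of b] hyps(2) 3 show ?thesis
        by (auto intro!: normalizable_Or elim!: normalizable_equivalent)
    next
      case (4 a b)
      with hyps(2) not_ab consider "boolean a" | "boolean b" by auto
      then show ?thesis
      proof cases
        case 1
        have "equivalent D (And \<alpha> \<beta>) (And a (And b \<beta>))"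
          by (auto simp: 4 equivalent_def diam_assoc)
        with IH'[of b] hyps(2) 4 1 show ?thesis
          by (auto intro!: normalizable_boolean_And elim!: normalizable_equivalent)
      next
        case 2
        have "equivalent D (And \<alpha> \<beta>) (And (And a \<beta>) b)"
          by (auto simp: 4 equivalent_def diam_boolean_right_commute[OF 2])
        with IH'[of a] hyps(2) 4 2 show ?thesis
          by (auto intro!: normalizable_And_boolean elim!: normalizable_equivalent)
      qed
    next
      case (5 a x)
      with not_AllFO show ?thesis by blast
    next
      case (6 a x)
      obtain y where y: "FO y \<notin> free \<beta> \<union> free a"
        using fresh_FO[of "free \<beta> \<union> free a"] by auto
      have "equivalent D (And \<alpha> \<beta>) (ExFO y (And (swap_FO x y a) \<beta>))"
        using y by (simp add: 6 equivalent_def free_swap_FO sem_at_swap_FO Un_Diff isum_diam)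
      then show ?thesis
        using IH'[of "swap_FO x y a"] hyps(2) 6
        by (auto intro!: normalizable_ExFO elim!: normalizable_equivalent)
    next
      case (7 a X)
      obtain Y where Y: "SO Y \<notin> free \<beta> \<union> free a"
        using fresh_SO[of "free \<beta> \<union> free a"] by auto
      have "equivalent D (And \<alpha> \<beta>) (ExSO Y (And (swap_SO X Y a) \<beta>))"
        using Y by (simp add: 7 equivalent_def free_swap_SO sem_at_swap_SO Un_Diff isum_diam)
      then show ?thesis
        using IH'[of "swap_SO X Y a"] hyps(2) 7
        by (auto intro!: normalizable_ExSO elim!: normalizable_equivalent)
    qed
  qed
  consider "\<And>x a. \<psi> \<noteq> AllFO x a" | "\<And>x a. \<theta> \<noteq> AllFO x a"
    | x a y b where "\<psi> = AllFO x a" "\<theta> = AllFO y b"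
    by blast
  then show ?case
  proof cases
    case 1
    with less.prems show ?thesis by (intro left) auto
  next
    case 2
    with less.prems have "normalizable D (And \<theta> \<psi>)"
      by (intro left) (auto intro: constants_commute_sym)
    moreover have "equivalent D (And \<psi> \<theta>) (And \<theta> \<psi>)"
      using less.prems by (intro equivalent_And_commute)
    ultimately show ?thesis
      by (blast intro: normalizable_equivalent)
  next
    case (3 x a y b)
    \<comment> \<open>One common variable for both quantifiers, so that the product of the
      valuations becomes a single valuation over \<open>z\<close>.\<close>
    obtain z where z: "FO z \<notin> free a \<union> free b"
      using fresh_FO[of "free a \<union> free b"] by auto
    define a' b' where "a' = swap_FO x z a" and "b' = swap_FO y z b"
    have comm: "constants_commute a b"
      using less.prems(5) by (simp add: 3 constants_commute_def)
    have "mval D (\<lambda>i. sem_at D nw a (s(x := i)) S) \<diamondop> mval D (\<lambda>i. sem_at D nw b (s(y := i)) S) =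
        mval D (\<lambda>i. sem_at D nw a (s(x := i)) S \<diamondop> sem_at D nw b (s(y := i)) S)" for nw s S
      using less.prems 3 comm by (intro mval_diam_mval values_commute) auto
    \<comment> \<open>The merged body is almost boolean whenever \<open>a\<close> and
      \<open>b\<close> are, which preserves \<forall>-restriction.\<close>
    then have "equivalent D (And \<psi> \<theta>) (AllFO z (And a' b'))"
      using z by (simp add: 3 equivalent_def a'_def b'_def free_swap_FO sem_at_swap_FO Un_Diff)
    moreover have "normalizable D (And a' b')"
      using less.prems 3 comm by (intro IH) (auto simp: a'_def b'_def constants_commute_def)
    ultimately show ?thesis
      by (rule normalizable_equivalent[OF _ normalizable_AllFO])
  qed
qed

end

section \<open>Normalization\<close>

text \<open>Both fragments constrain conjunctions only, so the \<open>And\<close> case is left as a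
  hypothesis to be discharged for each. Boolean formulas are kept whole, being normal
  already.\<close>

lemma MSO_normalizable:
  assumes "\<phi> \<in> MSO"
    and "\<And>\<psi> \<theta>. And \<psi> \<theta> \<in> subformulas \<phi> \<Longrightarrow>
      normalizable D \<psi> \<Longrightarrow> normalizable D \<theta> \<Longrightarrow> normalizable D (And \<psi> \<theta>)"
  shows "normalizable D \<phi>"
  using assms
proof (induction rule: MSO.induct)
  case (4 \<psi> \<theta>)
  have "normalizable D \<psi>"
    by (rule "4.IH"(1)) (simp add: "4.prems")
  moreover have "normalizable D \<theta>"
    by (rule "4.IH"(2)) (simp add: "4.prems")
  ultimately show ?case
    by (simp add: "4.prems")
next
  case (3 \<psi> \<theta>)
  have "normalizable D \<psi>"
    by (rule "3.IH"(1)) (simp add: "3.prems")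
  moreover have "normalizable D \<theta>"
    by (rule "3.IH"(2)) (simp add: "3.prems")
  ultimately show ?case by (rule normalizable_Or)
next
  case (5 \<psi> x)
  have "normalizable D \<psi>"
    by (rule "5.IH") (simp add: "5.prems")
  then show ?case by (rule normalizable_AllFO)
next
  case (6 \<psi> x)
  have "normalizable D \<psi>"
    by (rule "6.IH") (simp add: "6.prems")
  then show ?case by (rule normalizable_ExFO)
next
  case (7 \<psi> X)
  have "normalizable D \<psi>"
    by (rule "7.IH") (simp add: "7.prems")
  then show ?case by (rule normalizable_ExSO)
qed (simp_all add: normalizable_almost_boolean boolean_almost_boolean)

lemma (in left_distributive_pv_monoid) and_restricted_normalizable:
  assumes "\<phi> \<in> MSO" "and_restricted \<phi>"
  shows "normalizable D \<phi>"
  using assms(1)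
proof (rule MSO_normalizable)
  fix \<psi> \<theta>
  assume sub: "And \<psi> \<theta> \<in> subformulas \<phi>" and norm: "normalizable D \<psi>" "normalizable D \<theta>"
  obtain \<theta>' where \<theta>': "\<theta>' \<in> MSO" "strongly_and_restricted \<theta>'" "equivalent D \<theta> \<theta>'"
    using norm(2) unfolding normalizable_def by blast
  consider "almost_boolean \<psi>" | "boolean \<theta>"
    using sub assms(2) unfolding and_restricted_def by blast
  then show "normalizable D (And \<psi> \<theta>)"
  proof cases
    case 1
    \<comment> \<open>Only \<theta> is replaced; a normal form of \<psi> might no longer be almost
      boolean.\<close>
    have "equivalent D (And \<psi> \<theta>) (And \<psi> \<theta>')"
      using \<theta>'(3) by (intro equivalent_And) (simp_all add: equivalent_def)
    then show ?thesis
      by (rule normalizable_equivalent) (intro normalizable_almost_boolean_And 1 \<theta>'(1,2))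
  next
    case 2
    then show ?thesis
      using norm(1) by (intro normalizable_And_boolean)
  qed
qed

lemma (in cc_semiring) commutatively_and_restricted_normalizable:
  assumes "\<phi> \<in> MSO" "commutatively_and_restricted D \<phi>"
  shows "normalizable D \<phi>"
  using assms(1)
proof (rule MSO_normalizable)
  fix \<psi> \<theta>
  assume sub: "And \<psi> \<theta> \<in> subformulas \<phi>" and norm: "normalizable D \<psi>" "normalizable D \<theta>"
  obtain \<psi>' where \<psi>': "\<psi>' \<in> MSO" "strongly_and_restricted \<psi>'" "equivalent D \<psi> \<psi>'"
    using norm(1) unfolding normalizable_def by blast
  obtain \<theta>' where \<theta>': "\<theta>' \<in> MSO" "strongly_and_restricted \<theta>'" "equivalent D \<theta> \<theta>'"
    using norm(2) unfolding normalizable_def by blast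
  consider "almost_boolean \<psi>" | "constants_commute \<psi> \<theta>"
    using sub assms(2) unfolding commutatively_and_restricted_def constants_commute_def by blast
  then show "normalizable D (And \<psi> \<theta>)"
  proof cases
    case 1
    have "equivalent D (And \<psi> \<theta>) (And \<psi> \<theta>')"
      using \<theta>'(3) by (intro equivalent_And) (simp_all add: equivalent_def)
    then show ?thesis
      by (rule normalizable_equivalent) (intro normalizable_almost_boolean_And 1 \<theta>'(1,2))
  next
    case 2
    then have "constants_commute \<psi>' \<theta>'"
      using \<psi>'(3) \<theta>'(3) by (intro constants_commute_mono[OF 2]) (simp_all add: equivalent_def)
    with \<psi>' \<theta>' have "normalizable D (And \<psi>' \<theta>')"
      by (intro normalizable_commuting_And)
    then show ?thesis
      by (rule normalizable_equivalent[OF equivalent_And[OF \<psi>'(3) \<theta>'(3)]])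
  qed
qed

theorem theorem15:
  fixes D :: "('d, 'i) pv_struct"
    and \<phi> :: "('a::finite, 'd) fm"
  assumes index_universe: "\<exists>e :: nat set \<Rightarrow> 'i. inj e"
    and "omega_pv_monoid D"
    and "\<phi> \<in> MSO"
  shows "(left_distributive D \<and> and_restricted \<phi> \<longrightarrow>
            (\<exists>\<phi>' \<in> MSO. strongly_and_restricted \<phi>' \<and> same_semantics D \<phi> \<phi>') \<and>
            (forall_restricted \<phi> \<longrightarrow>
              (\<exists>\<phi>' \<in> MSO. strongly_and_restricted \<phi>' \<and> forall_restricted \<phi>' \<and>
                 same_semantics D \<phi> \<phi>'))) \<and>
         (cc_omega_valuation_semiring D \<and> commutatively_and_restricted D \<phi> \<longrightarrow>
            (\<exists>\<phi>' \<in> MSO. strongly_and_restricted \<phi>' \<and> same_semantics D \<phi> \<phi>') \<and>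
            (forall_restricted \<phi> \<longrightarrow>
              (\<exists>\<phi>' \<in> MSO. strongly_and_restricted \<phi>' \<and> forall_restricted \<phi>' \<and>
                 same_semantics D \<phi> \<phi>')))"
proof -
  obtain e :: "nat set \<Rightarrow> 'i" where "inj e"
    using index_universe by blast
  \<comment> \<open>The images of two distinct sets of positions provide the two indices that the
    locales require.\<close>
  then have "e {} \<noteq> e UNIV"
    by (simp add: inj_eq)
  then have two: "\<exists>j k :: 'i. j \<noteq> k" by blast
  \<comment> \<open>One witness settles both assertions, since \<open>equivalent\<close> already
    transfers \<forall>-restriction.\<close>
  have claim: "(\<exists>\<phi>' \<in> MSO. strongly_and_restricted \<phi>' \<and> same_semantics D \<phi> \<phi>') \<and>
      (forall_restricted \<phi> \<longrightarrow> (\<exists>\<phi>' \<in> MSO. strongly_and_restricted \<phi>' \<and> forall_restricted \<phi>' \<and>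
         same_semantics D \<phi> \<phi>'))" if "normalizable D \<phi>"
  proof -
    from that obtain \<phi>' where "\<phi>' \<in> MSO" "strongly_and_restricted \<phi>'" "equivalent D \<phi> \<phi>'"
      by (auto simp: normalizable_def)
    moreover have "forall_restricted \<phi> \<Longrightarrow> forall_restricted \<phi>'"
      using \<open>equivalent D \<phi> \<phi>'\<close> by (simp add: equivalent_def)
    ultimately show ?thesis
      using equivalent_same_semantics by blast
  qed
  have "normalizable D \<phi>" if "left_distributive D" "and_restricted \<phi>"
    using that assms two
    by (intro left_distributive_pv_monoid.and_restricted_normalizable)
      (simp_all add: left_distributive_pv_monoid_def left_distributive_pv_monoid_axioms_def)
  moreover have "normalizable D \<phi>"
    if "cc_omega_valuation_semiring D" "commutatively_and_restricted D \<phi>"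
    using that assms two
    by (intro cc_semiring.commutatively_and_restricted_normalizable)
      (simp_all add: cc_semiring_def cc_semiring_axioms_def)
  ultimately show ?thesis
    using claim by blast
qed

end
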